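(* Let $\mathcal{R} = \langle R; <, +, \ldots\rangle$ be an expansion of a densely ordered Abelian group which is definably complete and has burden at most $2$. Then there is no definable Cantor-like set in $\mathcal{R}$.
   Context: Standing assumption: $\mathcal{R}$ is sufficiently saturated ($|T|^+$-saturated, where $T = \mathrm{Th}(\mathcal{R})$). A densely ordered Abelian group is an Abelian group with a translation-invariant dense total order. "Definable" means definable in $\mathcal{R}$ with parameters. All topological notions refer to the order topology generated by open intervals. $\mathcal{R}$ is definably complete if every nonempty definable subset of $R$ which has an upper bound has a supremum in $R$. A set $X \subseteq R$ is Cantor-like if it is nonempty, closed, nowhere dense, and has no isolated points. An inp-pattern of depth $\kappa$ in a partial type $p(\overline{x})$ is a sequence of formulas $\{\varphi_i(\overline{x};\overline{y}_i) : i<\kappa\}$, a sequence of positive integers $\{k_i : i<\kappa\}$, and a sequence of tuples $\{\overline{a}_{i,j} : i<\kappa, j<\omega\}$ from some model of $T$ such that for each $i<\kappa$ the set $\{\varphi_i(\overline{x};\overline{a}_{i,j}) : j<\omega\}$ is $k_i$-inconsistent, and for each $\eta:\kappa\to\omega$ the set $p(\overline{x}) \cup \{\varphi_i(\overline{x};\overline{a}_{i,\eta(i)}) : i<\kappa\}$ is consistent. The partial type $p$ has burden less than $\kappa$ if there is no inp-pattern of depth $\kappa$ in $p$; its burden is $\lambda$ if the least $\kappa$ such that the burden of $p$ is less than $\kappa$ is $\lambda^+$. The burden of $\mathcal{R}$ (or of $T$) is the burden of the partial type $x=x$ in a single variable $x$. *)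

theory Defs
  imports "HOL-Analysis.Analysis"
begin

unbundle cardinal_syntax

section \<open>First-order logic with equality\<close>

record ('f, 'r) lang =
  farity :: "'f \<Rightarrow> nat"
  rarity :: "'r \<Rightarrow> nat"

datatype 'f trm = Var nat | App 'f "'f trm list"

datatype ('f, 'r) fm =
    Eql "'f trm" "'f trm"
  | Rel 'r "'f trm list"
  | Neg "('f, 'r) fm"
  | Con "('f, 'r) fm" "('f, 'r) fm"
  | Exi nat "('f, 'r) fm"

fun wf_trm :: "('f, 'r) lang \<Rightarrow> 'f trm \<Rightarrow> bool" where
  "wf_trm L (Var v) \<longleftrightarrow> True"
| "wf_trm L (App f ts) \<longleftrightarrow> length ts = farity L f \<and> (\<forall>t\<in>set ts. wf_trm L t)"

fun wf_fm :: "('f, 'r) lang \<Rightarrow> ('f, 'r) fm \<Rightarrow> bool" where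
  "wf_fm L (Eql s t) \<longleftrightarrow> wf_trm L s \<and> wf_trm L t"
| "wf_fm L (Rel r ts) \<longleftrightarrow> length ts = rarity L r \<and> (\<forall>t\<in>set ts. wf_trm L t)"
| "wf_fm L (Neg \<phi>) \<longleftrightarrow> wf_fm L \<phi>"
| "wf_fm L (Con \<phi> \<psi>) \<longleftrightarrow> wf_fm L \<phi> \<and> wf_fm L \<psi>"
| "wf_fm L (Exi v \<phi>) \<longleftrightarrow> wf_fm L \<phi>"

fun fv_trm :: "'f trm \<Rightarrow> nat set" where
  "fv_trm (Var v) = {v}"
| "fv_trm (App f ts) = (\<Union>t\<in>set ts. fv_trm t)"

fun fv_fm :: "('f, 'r) fm \<Rightarrow> nat set" where
  "fv_fm (Eql s t) = fv_trm s \<union> fv_trm t"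
| "fv_fm (Rel r ts) = (\<Union>t\<in>set ts. fv_trm t)"
| "fv_fm (Neg \<phi>) = fv_fm \<phi>"
| "fv_fm (Con \<phi> \<psi>) = fv_fm \<phi> \<union> fv_fm \<psi>"
| "fv_fm (Exi v \<phi>) = fv_fm \<phi> - {v}"

text \<open>The universe of a structure is the whole type \<open>'a\<close>.  Interpretations take argument
  lists; their values on lists of the wrong length are never seen by well-formed formulas.\<close>

record ('f, 'r, 'a) struct =
  finterp :: "'f \<Rightarrow> 'a list \<Rightarrow> 'a"
  rinterp :: "'r \<Rightarrow> 'a list \<Rightarrow> bool"

fun val :: "('f, 'r, 'a) struct \<Rightarrow> (nat \<Rightarrow> 'a) \<Rightarrow> 'f trm \<Rightarrow> 'a" where
  "val M e (Var v) = e v"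
| "val M e (App f ts) = finterp M f (map (val M e) ts)"

fun sat :: "('f, 'r, 'a) struct \<Rightarrow> (nat \<Rightarrow> 'a) \<Rightarrow> ('f, 'r) fm \<Rightarrow> bool" where
  "sat M e (Eql s t) \<longleftrightarrow> val M e s = val M e t"
| "sat M e (Rel r ts) \<longleftrightarrow> rinterp M r (map (val M e) ts)"
| "sat M e (Neg \<phi>) \<longleftrightarrow> \<not> sat M e \<phi>"
| "sat M e (Con \<phi> \<psi>) \<longleftrightarrow> sat M e \<phi> \<and> sat M e \<psi>"
| "sat M e (Exi v \<phi>) \<longleftrightarrow> (\<exists>b. sat M (e(v := b)) \<phi>)"

definition Th :: "('f, 'r) lang \<Rightarrow> ('f, 'r, 'a) struct \<Rightarrow> ('f, 'r) fm set" where
  "Th L M = {\<phi>. wf_fm L \<phi> \<and> fv_fm \<phi> = {} \<and> (\<forall>e. sat M e \<phi>)}"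

definition is_model :: "('f, 'r, 'a) struct \<Rightarrow> ('f, 'r) fm set \<Rightarrow> bool" where
  "is_model N T \<longleftrightarrow> (\<forall>\<phi>\<in>T. \<forall>e. sat N e \<phi>)"

section \<open>Formulas with parameters in one object variable, definability, saturation\<close>

text \<open>Variable \<open>0\<close> is the object variable \<open>x\<close>.  A formula \<open>\<phi>(x; a)\<close> with a tuple \<open>a\<close> of
  parameters is encoded as a pair \<open>(\<phi>, e)\<close>, where the assignment \<open>e\<close> gives the values of the
  parameter variables, i.e. of the (finitely many) free variables of \<open>\<phi>\<close> other than \<open>0\<close>;
  the remaining values of \<open>e\<close> are irrelevant.\<close>

type_synonym ('f, 'r, 'a) pfm = "('f, 'r) fm \<times> (nat \<Rightarrow> 'a)"

definition holds_at :: "('f, 'r, 'a) struct \<Rightarrow> 'a \<Rightarrow> ('f, 'r, 'a) pfm \<Rightarrow> bool" where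
  "holds_at M b \<theta> \<longleftrightarrow> sat M ((snd \<theta>)(0 := b)) (fst \<theta>)"

definition pfm_over :: "('f, 'r) lang \<Rightarrow> 'a set \<Rightarrow> ('f, 'r, 'a) pfm \<Rightarrow> bool" where
  "pfm_over L A \<theta> \<longleftrightarrow> wf_fm L (fst \<theta>) \<and> (\<forall>v \<in> fv_fm (fst \<theta>) - {0}. snd \<theta> v \<in> A)"

definition definable :: "('f, 'r) lang \<Rightarrow> ('f, 'r, 'a) struct \<Rightarrow> 'a set \<Rightarrow> bool" where
  "definable L M X \<longleftrightarrow> (\<exists>\<theta>. pfm_over L UNIV \<theta> \<and> X = {b. holds_at M b \<theta>})"

text \<open>Consistency of a set of formulas with parameters in \<open>M\<close> is consistency with the complete
  theory of \<open>M\<close> with its elements named, that is, finite satisfiability in \<open>M\<close>.\<close>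

definition consistent :: "('f, 'r, 'a) struct \<Rightarrow> ('f, 'r, 'a) pfm set \<Rightarrow> bool" where
  "consistent M \<Sigma> \<longleftrightarrow> (\<forall>\<Sigma>0\<subseteq>\<Sigma>. finite \<Sigma>0 \<longrightarrow> (\<exists>b. \<forall>\<theta>\<in>\<Sigma>0. holds_at M b \<theta>))"

definition saturated :: "('f, 'r) lang \<Rightarrow> ('f, 'r, 'a) struct \<Rightarrow> 'k rel \<Rightarrow> bool" where
  "saturated L M \<kappa> \<longleftrightarrow>
     (\<forall>A \<Sigma>. |A| <o \<kappa> \<longrightarrow> (\<forall>\<theta>\<in>\<Sigma>. pfm_over L A \<theta>) \<longrightarrow> consistent M \<Sigma> \<longrightarrow>
        (\<exists>b. \<forall>\<theta>\<in>\<Sigma>. holds_at M b \<theta>))"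

section \<open>Burden\<close>

text \<open>The partial type \<open>p\<close> is a set of formulas in \<open>x\<close> without parameters, and the depth is the
  index set \<open>I\<close>.  As usual, \<open>k\<close>-inconsistency refers to the indexed family: any \<open>k\<close> distinct
  indices \<open>j\<close> give inconsistent instances.  (For the bare set of instances, a constant sequence
  would be vacuously \<open>2\<close>-inconsistent.)\<close>

definition inp_pattern ::
  "('f, 'r) lang \<Rightarrow> ('f, 'r, 'a) struct \<Rightarrow> ('f, 'r) fm set \<Rightarrow> 'i set \<Rightarrow>
   ('i \<Rightarrow> ('f, 'r) fm) \<Rightarrow> ('i \<Rightarrow> nat) \<Rightarrow> ('i \<Rightarrow> nat \<Rightarrow> nat \<Rightarrow> 'a) \<Rightarrow> bool" where
  "inp_pattern L N p I \<phi> k a \<longleftrightarrow>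
     (\<forall>i\<in>I. wf_fm L (\<phi> i) \<and> k i > 0 \<and>
        (\<forall>J. finite J \<and> card J = k i \<longrightarrow> \<not> consistent N {(\<phi> i, a i j) |j. j \<in> J})) \<and>
     (\<forall>\<eta> :: 'i \<Rightarrow> nat. consistent N (p \<times> UNIV \<union> {(\<phi> i, a i (\<eta> i)) |i. i \<in> I}))"

text \<open>Finite depths suffice for the notion of burden at most \<open>n\<close>.  The parameters of a pattern
  lie in some model of the theory of \<open>M\<close>; models are taken on the type \<open>'a\<close> of \<open>M\<close>.  For
  \<open>M\<close> saturated in the cardinality successor of its theory this is no restriction: a pattern
  in a model on any other type can be found in \<open>M\<close> itself.\<close>

definition burden_less ::
  "('f, 'r) lang \<Rightarrow> ('f, 'r, 'a) struct \<Rightarrow> ('f, 'r) fm set \<Rightarrow> nat \<Rightarrow> bool" where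
  "burden_less L M p \<kappa> \<longleftrightarrow>
     \<not> (\<exists>(N :: ('f, 'r, 'a) struct) \<phi> k a.
           is_model N (Th L M) \<and> inp_pattern L N p {..<\<kappa>} \<phi> k a)"

definition has_burden ::
  "('f, 'r) lang \<Rightarrow> ('f, 'r, 'a) struct \<Rightarrow> ('f, 'r) fm set \<Rightarrow> nat \<Rightarrow> bool" where
  "has_burden L M p n \<longleftrightarrow>
     burden_less L M p (Suc n) \<and> (\<forall>\<kappa> < Suc n. \<not> burden_less L M p \<kappa>)"

definition burden_at_most :: "('f, 'r) lang \<Rightarrow> ('f, 'r, 'a) struct \<Rightarrow> nat \<Rightarrow> bool" where
  "burden_at_most L M n \<longleftrightarrow> (\<exists>m\<le>n. has_burden L M {Eql (Var 0) (Var 0)} m)"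

section \<open>Expansions of ordered groups\<close>

definition expands_ordered_group ::
  "('f, 'r) lang \<Rightarrow> ('f, 'r, 'a::linordered_ab_group_add) struct \<Rightarrow> 'f \<Rightarrow> 'r \<Rightarrow> bool" where
  "expands_ordered_group L M pls lt \<longleftrightarrow>
     farity L pls = 2 \<and> (\<forall>x y. finterp M pls [x, y] = x + y) \<and>
     rarity L lt = 2 \<and> (\<forall>x y. rinterp M lt [x, y] \<longleftrightarrow> x < y)"

definition definably_complete :: "('f, 'r) lang \<Rightarrow> ('f, 'r, 'a::linorder) struct \<Rightarrow> bool" where
  "definably_complete L M \<longleftrightarrow>
     (\<forall>X. definable L M X \<and> X \<noteq> {} \<and> bdd_above X \<longrightarrow>
        (\<exists>s. (\<forall>x\<in>X. x \<le> s) \<and> (\<forall>u. (\<forall>x\<in>X. x \<le> u) \<longrightarrow> s \<le> u)))"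

definition Cantor_like :: "'a::topological_space set \<Rightarrow> bool" where
  "Cantor_like X \<longleftrightarrow>
     X \<noteq> {} \<and> closed X \<and> interior (closure X) = {} \<and> \<not> (\<exists>x\<in>X. x isolated_in X)"

end

theory Submission
  imports Defs
begin

text \<open>
  A definable Cantor-like set \<open>X\<close> would give inp-patterns of every finite depth, contrary to the
  bound on the burden.

  For \<open>\<epsilon> > 0\<close> call a point of \<open>X\<close> an \<open>\<epsilon>\<close>-gap point (\<open>gap_points\<close>) if every later point of
  \<open>X\<close> is more than \<open>\<epsilon>\<close> away.  Near any of its points \<open>X\<close> is infinite, having no isolated
  points, and between any two points of \<open>X\<close> there is a gap, since \<open>X\<close> is nowhere dense and
  definable completeness provides the left end of a gap.  So every interval around a point of \<open>X\<close>
  contains infinitely many gap points, a priori for different \<open>\<epsilon>\<close>; saturation, applied to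
  countably many of them, gives one \<open>\<epsilon>\<close> that works for infinitely many of them
  (\<open>infinite_gap_points\<close>).  Thus arbitrarily short intervals contain infinite sets of points that
  are more than \<open>\<epsilon>\<close> apart, for a suitable \<open>\<epsilon>\<close>.

  Now choose scales \<open>\<epsilon> 1 > \<epsilon> 2 > \<dots>\<close> with infinite sets \<open>D i\<close> of \<open>\<epsilon> i\<close>-gap points such that
  \<open>D (i + 1)\<close> lies in an interval much shorter than \<open>\<epsilon> i\<close>.  After translation of each \<open>D i\<close> to an
  interval beginning at \<open>0\<close>, a sum \<open>x = d 1 + \<dots> + d n\<close> of elements of these sets determines its
  summands definably, like a number its digits: \<open>d 1\<close> is the only candidate with \<open>x\<close> between \<open>d 1\<close>
  and \<open>d 1 + \<epsilon> 1\<close>, and the others are found from \<open>x - d 1\<close> in the same way.  The formulas saying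
  that the \<open>i\<close>-th summand of \<open>x\<close> is \<open>d\<close> form an inp-pattern of depth \<open>n\<close> with \<open>2\<close>-inconsistent
  rows (\<open>nested_scales\<close>; a little room is left beyond \<open>d n\<close>).

  Formulas for these sets are never written out.  The relations on assignments that are definable
  with parameters are shown to be closed under the logical operations and under substitution, and
  saturation and burden are restated for definable families of sets.
\<close>

section \<open>Renaming variables\<close>

lemma finite_fv_trm: "finite (fv_trm t)"
  by (induction t) auto

lemma finite_fv_fm: "finite (fv_fm \<phi>)"
  by (induction \<phi>) (auto simp: finite_fv_trm)

lemma val_cong: "(\<And>v. v \<in> fv_trm t \<Longrightarrow> e v = e' v) \<Longrightarrow> val M e t = val M e' t"
proof (induction t)
  case (App f ts)
  then have "map (val M e) ts = map (val M e') ts"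
    by auto
  then show ?case
    by (simp only: val.simps)
qed simp

lemma sat_cong: "(\<And>v. v \<in> fv_fm \<phi> \<Longrightarrow> e v = e' v) \<Longrightarrow> sat M e \<phi> \<longleftrightarrow> sat M e' \<phi>"
proof (induction \<phi> arbitrary: e e')
  case (Eql s t)
  then show ?case
    using val_cong[of s e e' M] val_cong[of t e e' M] by auto
next
  case (Rel r ts)
  then have "map (val M e) ts = map (val M e') ts"
    by (auto intro!: val_cong)
  then show ?case
    by (simp only: sat.simps)
next
  case (Neg \<phi>)
  then show ?case
    by (metis fv_fm.simps(3) sat.simps(3))
next
  case (Con \<phi> \<psi>)
  then show ?case
    by (metis UnI1 UnI2 fv_fm.simps(4) sat.simps(4))
next
  case (Exi v \<phi>)
  have "sat M (e(v := b)) \<phi> \<longleftrightarrow> sat M (e'(v := b)) \<phi>" for b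
    by (rule Exi.IH) (use Exi.prems in auto)
  then show ?case
    by simp
qed

fun rename_trm :: "(nat \<Rightarrow> nat) \<Rightarrow> 'f trm \<Rightarrow> 'f trm" where
  "rename_trm \<sigma> (Var v) = Var (\<sigma> v)"
| "rename_trm \<sigma> (App f ts) = App f (map (rename_trm \<sigma>) ts)"

lemma wf_rename_trm: "wf_trm L t \<Longrightarrow> wf_trm L (rename_trm \<sigma> t)"
  by (induction t) auto

lemma val_rename_trm: "val M e (rename_trm \<sigma> t) = val M (e \<circ> \<sigma>) t"
proof (induction t)
  case (App f ts)
  then have "map (val M e \<circ> rename_trm \<sigma>) ts = map (val M (e \<circ> \<sigma>)) ts"
    by (auto simp: o_def)
  then show ?case
    by (simp only: rename_trm.simps val.simps list.map_comp)
qed simp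

text \<open>
  Only the existence of the renamed formula matters, so bound variables may be changed at will to
  avoid capture.
\<close>

lemma rename_fm:
  assumes "wf_fm L \<phi>"
  shows "\<exists>\<psi>. wf_fm L \<psi> \<and> (\<forall>e. sat M e \<psi> \<longleftrightarrow> sat M (e \<circ> \<sigma>) \<phi>)"
  using assms
proof (induction \<phi> arbitrary: \<sigma>)
  case (Eql s t)
  then show ?case
    by (intro exI[of _ "Eql (rename_trm \<sigma> s) (rename_trm \<sigma> t)"])
      (simp add: wf_rename_trm val_rename_trm del: o_apply)
next
  case (Rel r ts)
  have "map (val M e \<circ> rename_trm \<sigma>) ts = map (val M (e \<circ> \<sigma>)) ts" for e
    by (auto simp: val_rename_trm)
  then show ?case
    using Rel by (intro exI[of _ "Rel r (map (rename_trm \<sigma>) ts)"])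
      (simp add: wf_rename_trm del: o_apply map_eq_conv)
next
  case (Neg \<phi>)
  from Neg.prems obtain \<psi> where "wf_fm L \<psi>" "\<forall>e. sat M e \<psi> \<longleftrightarrow> sat M (e \<circ> \<sigma>) \<phi>"
    using Neg.IH[of \<sigma>] by (auto simp del: o_apply)
  then show ?case
    by (intro exI[of _ "Neg \<psi>"]) (simp del: o_apply)
next
  case (Con \<phi>1 \<phi>2)
  then obtain \<psi>1 \<psi>2 where "wf_fm L \<psi>1" "\<forall>e. sat M e \<psi>1 \<longleftrightarrow> sat M (e \<circ> \<sigma>) \<phi>1"
    "wf_fm L \<psi>2" "\<forall>e. sat M e \<psi>2 \<longleftrightarrow> sat M (e \<circ> \<sigma>) \<phi>2"
    by (metis wf_fm.simps(4))
  then show ?case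
    by (intro exI[of _ "Con \<psi>1 \<psi>2"]) (simp del: o_apply)
next
  case (Exi v \<phi>)
  have "finite (\<sigma> ` fv_fm \<phi>)"
    by (simp add: finite_fv_fm)
  \<comment> \<open>The bound variable becomes one that no free variable is renamed to.\<close>
  then obtain w where w: "w \<notin> \<sigma> ` fv_fm \<phi>"
    using ex_new_if_finite infinite_UNIV_nat by blast
  obtain \<psi> where \<psi>: "wf_fm L \<psi>" "\<forall>e. sat M e \<psi> \<longleftrightarrow> sat M (e \<circ> \<sigma>(v := w)) \<phi>"
    using Exi.IH[of "\<sigma>(v := w)"] Exi.prems by (metis wf_fm.simps(5))
  have "sat M (e(w := b) \<circ> \<sigma>(v := w)) \<phi> \<longleftrightarrow> sat M ((e \<circ> \<sigma>)(v := b)) \<phi>" for e b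
    by (rule sat_cong) (use w in auto)
  with \<psi> show ?case
    by (intro exI[of _ "Exi w \<psi>"]) (simp del: o_apply)
qed

section \<open>Definable relations between the values of an assignment\<close>

text \<open>
  The table \<open>\<tau>\<close> sends a variable of a formula either to an argument position of a relation or to
  a parameter.  A parameter can therefore be added without making room among the argument
  positions, and an argument may be read through several variables of the formula.
\<close>

definition env :: "(nat \<Rightarrow> 'a) \<Rightarrow> (nat \<Rightarrow> nat + 'a) \<Rightarrow> nat \<Rightarrow> 'a" where
  "env e \<tau> i = (case \<tau> i of Inl j \<Rightarrow> e j | Inr c \<Rightarrow> c)"

definition definable_rel ::
  "('f, 'r) lang \<Rightarrow> ('f, 'r, 'a) struct \<Rightarrow> ((nat \<Rightarrow> 'a) \<Rightarrow> bool) \<Rightarrow> bool" where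
  "definable_rel L M P \<longleftrightarrow> (\<exists>\<phi> \<tau>. wf_fm L \<phi> \<and> (\<forall>e. P e \<longleftrightarrow> sat M (env e \<tau>) \<phi>))"

lemma definable_relI:
  "wf_fm L \<phi> \<Longrightarrow> (\<And>e. P e \<longleftrightarrow> sat M (env e \<tau>) \<phi>) \<Longrightarrow> definable_rel L M P"
  unfolding definable_rel_def by blast

text \<open>
  Variable \<open>0\<close> of a formula is reserved for the object variable, and quantification takes place
  over the first argument of a relation.  Both uses need a formula in which the first argument is
  read through variable \<open>0\<close> and through no other; the remaining arguments then move down by one
  position.
\<close>

lemma definable_rel_object_variable:
  assumes "definable_rel L M P"
  obtains \<psi> \<tau> where "wf_fm L \<psi>"
    and "\<And>x e. P (case_nat x e) \<longleftrightarrow> sat M ((env e \<tau>)(0 := x)) \<psi>"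
proof -
  obtain \<phi> \<tau> where \<phi>: "wf_fm L \<phi>" "\<And>e. P e \<longleftrightarrow> sat M (env e \<tau>) \<phi>"
    using assms unfolding definable_rel_def by blast
  define \<sigma> where "\<sigma> i = (if \<tau> i = Inl 0 then 0 else Suc i)" for i
  obtain \<psi> where \<psi>: "wf_fm L \<psi>" "\<And>e. sat M e \<psi> \<longleftrightarrow> sat M (e \<circ> \<sigma>) \<phi>"
    using rename_fm[OF \<phi>(1), of M \<sigma>] by blast
  \<comment> \<open>The value at \<open>0\<close> gets overwritten, and variables outside the range of \<open>\<sigma>\<close> are not read.\<close>
  define \<tau>' where
    "\<tau>' i = (case \<tau> (i - 1) of Inl j \<Rightarrow> Inl (j - 1) | Inr c \<Rightarrow> Inr c)" for i
  have "(env e \<tau>')(0 := x) \<circ> \<sigma> = env (case_nat x e) \<tau>" for x e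
    by (rule ext) (auto simp: env_def \<sigma>_def \<tau>'_def split: sum.split nat.split)
  then show thesis
    using that[of \<psi> \<tau>'] \<psi> \<phi>(2) by simp
qed

lemma definable_rel_not: "definable_rel L M P \<Longrightarrow> definable_rel L M (\<lambda>e. \<not> P e)"
  unfolding definable_rel_def by (metis sat.simps(3) wf_fm.simps(3))

lemma definable_rel_conj:
  assumes "definable_rel L M P" "definable_rel L M Q"
  shows "definable_rel L M (\<lambda>e. P e \<and> Q e)"
proof -
  obtain \<phi>1 \<tau>1 where 1: "wf_fm L \<phi>1" "\<And>e. P e \<longleftrightarrow> sat M (env e \<tau>1) \<phi>1"
    using assms(1) unfolding definable_rel_def by blast
  obtain \<phi>2 \<tau>2 where 2: "wf_fm L \<phi>2" "\<And>e. Q e \<longleftrightarrow> sat M (env e \<tau>2) \<phi>2"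
    using assms(2) unfolding definable_rel_def by blast
  \<comment> \<open>The two formulas get disjoint sets of variables, since their parameters may differ.\<close>
  obtain \<psi>1 where \<psi>1: "wf_fm L \<psi>1" "\<And>e. sat M e \<psi>1 \<longleftrightarrow> sat M (e \<circ> (\<lambda>i. 2 * i)) \<phi>1"
    using rename_fm[OF 1(1)] by metis
  obtain \<psi>2 where \<psi>2: "wf_fm L \<psi>2" "\<And>e. sat M e \<psi>2 \<longleftrightarrow> sat M (e \<circ> (\<lambda>i. 2 * i + 1)) \<phi>2"
    using rename_fm[OF 2(1)] by metis
  define \<tau> where "\<tau> i = (if even i then \<tau>1 (i div 2) else \<tau>2 (i div 2))" for i
  have "env e \<tau> \<circ> (\<lambda>i. 2 * i) = env e \<tau>1" "env e \<tau> \<circ> (\<lambda>i. 2 * i + 1) = env e \<tau>2" for e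
    by (auto simp: env_def \<tau>_def fun_eq_iff)
  then show ?thesis
    using 1 2 \<psi>1 \<psi>2 by (intro definable_relI[of L "Con \<psi>1 \<psi>2" _ M \<tau>]) simp_all
qed

lemma definable_rel_imp:
  assumes "definable_rel L M P" "definable_rel L M Q"
  shows "definable_rel L M (\<lambda>e. P e \<longrightarrow> Q e)"
  using definable_rel_not[OF definable_rel_conj[OF assms(1) definable_rel_not[OF assms(2)]]]
  by simp

text \<open>
  Quantifiers bind in the style of de Bruijn: below a quantifier, position \<open>0\<close> is the bound
  element and the old positions are shifted.  In this form the rule is a higher-order pattern, so
  that definability is proved by backward chaining along the structure of a proposition.
\<close>

lemma definable_rel_ex:
  assumes "definable_rel L M (\<lambda>e. P (e 0) (\<lambda>i. e (Suc i)))"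
  shows "definable_rel L M (\<lambda>e. \<exists>b. P b e)"
proof -
  obtain \<psi> \<tau> where "wf_fm L \<psi>" "\<And>x e. P x e \<longleftrightarrow> sat M ((env e \<tau>)(0 := x)) \<psi>"
    using definable_rel_object_variable[OF assms] by auto
  then show ?thesis
    by (intro definable_relI[of L "Exi 0 \<psi>" _ M \<tau>]) auto
qed

lemma definable_rel_all:
  assumes "definable_rel L M (\<lambda>e. P (e 0) (\<lambda>i. e (Suc i)))"
  shows "definable_rel L M (\<lambda>e. \<forall>b. P b e)"
  using definable_rel_not[OF definable_rel_ex[OF definable_rel_not[OF assms]]] by simp

lemma definable_rel_reindex:
  assumes "definable_rel L M P"
  shows "definable_rel L M (\<lambda>e. P (\<lambda>i. e (\<sigma> i)))"
proof -
  obtain \<phi> \<tau> where \<phi>: "wf_fm L \<phi>" "\<And>e. P e \<longleftrightarrow> sat M (env e \<tau>) \<phi>"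
    using assms unfolding definable_rel_def by blast
  have "env e (\<lambda>i. map_sum \<sigma> id (\<tau> i)) = env (\<lambda>i. e (\<sigma> i)) \<tau>" for e
    by (auto simp: env_def fun_eq_iff split: sum.split)
  with \<phi> show ?thesis
    by (intro definable_relI[of L \<phi> _ M "\<lambda>i. map_sum \<sigma> id (\<tau> i)"]) simp_all
qed

definition definable_fun ::
  "('f, 'r) lang \<Rightarrow> ('f, 'r, 'a) struct \<Rightarrow> ((nat \<Rightarrow> 'a) \<Rightarrow> 'a) \<Rightarrow> bool" where
  "definable_fun L M t \<longleftrightarrow> definable_rel L M (\<lambda>e. e 0 = t (\<lambda>i. e (Suc i)))"

lemma definable_fun_reindex:
  assumes "definable_fun L M t"
  shows "definable_fun L M (\<lambda>e. t (\<lambda>i. e (\<sigma> i)))"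
  using definable_rel_reindex[OF assms[unfolded definable_fun_def],
      of "case_nat 0 (\<lambda>i. Suc (\<sigma> i))"]
  by (simp add: definable_fun_def)

text \<open>Substitution of a term for a variable, in the form \<open>\<exists>b. b = t e \<and> P b e\<close>.\<close>

lemma definable_rel_subst:
  assumes "definable_fun L M t" "definable_rel L M (\<lambda>e. P (e 0) (\<lambda>i. e (Suc i)))"
  shows "definable_rel L M (\<lambda>e. P (t e) e)"
proof -
  have "definable_rel L M (\<lambda>e. \<exists>b. b = t e \<and> P b e)"
    by (intro definable_rel_ex definable_rel_conj assms assms(1)[unfolded definable_fun_def])
  then show ?thesis
    by simp
qed

lemma definable_rel_subst2:
  assumes "definable_fun L M s" "definable_fun L M t" "definable_rel L M (\<lambda>e. Q (e 0) (e 1))"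
  shows "definable_rel L M (\<lambda>e. Q (s e) (t e))"
proof (rule definable_rel_subst[OF assms(1)])
  have "definable_rel L M (\<lambda>e. Q (e 1) (e 0))"
    using definable_rel_reindex[OF assms(3), of "\<lambda>i. 1 - i"] by simp
  then show "definable_rel L M (\<lambda>e. Q (e 0) (t (\<lambda>i. e (Suc i))))"
    using definable_rel_subst[OF definable_fun_reindex[OF assms(2)], of "\<lambda>b e. Q (e 0) b"]
    by simp
qed

lemma definable_fun_var: "definable_fun L M (\<lambda>e. e i)"
  unfolding definable_fun_def
  by (rule definable_relI[of L "Eql (Var 0) (Var (Suc i))" _ M Inl]) (auto simp: env_def)

lemma definable_fun_const: "definable_fun L M (\<lambda>e. c)"
  unfolding definable_fun_def
  by (rule definable_relI[of L "Eql (Var 0) (Var 1)" _ M "case_nat (Inl 0) (\<lambda>_. Inr c)"])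
    (auto simp: env_def)

lemma definable_rel_eq:
  assumes "definable_fun L M s" "definable_fun L M t"
  shows "definable_rel L M (\<lambda>e. s e = t e)"
  by (rule definable_rel_subst2[OF assms])
    (rule definable_relI[of L "Eql (Var 0) (Var 1)" _ M Inl]; simp add: env_def)

lemma definable_iff_definable_rel: "definable L M X \<longleftrightarrow> definable_rel L M (\<lambda>e. e 0 \<in> X)"
proof
  assume "definable L M X"
  then obtain \<theta> where \<theta>: "pfm_over L UNIV \<theta>" "X = {b. holds_at M b \<theta>}"
    unfolding definable_def by blast
  have "(snd \<theta>)(0 := e 0) = env e (\<lambda>i. if i = 0 then Inl 0 else Inr (snd \<theta> i))" for e
    by (auto simp: env_def)
  with \<theta> show "definable_rel L M (\<lambda>e. e 0 \<in> X)"
    by (intro definable_relI[of L "fst \<theta>" _ M "\<lambda>i. if i = 0 then Inl 0 else Inr (snd \<theta> i)"])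
      (auto simp: holds_at_def pfm_over_def)
next
  assume "definable_rel L M (\<lambda>e. e 0 \<in> X)"
  then obtain \<psi> \<tau> where "wf_fm L \<psi>" "\<And>x e. x \<in> X \<longleftrightarrow> sat M ((env e \<tau>)(0 := x)) \<psi>"
    using definable_rel_object_variable by (metis nat.case(1))
  then show "definable L M X"
    unfolding definable_def
    by (intro exI[of _ "(\<psi>, env undefined \<tau>)"]) (auto simp: holds_at_def pfm_over_def)
qed

lemma definable_rel_mem:
  assumes "definable L M X" "definable_fun L M t"
  shows "definable_rel L M (\<lambda>e. t e \<in> X)"
  using assms definable_rel_subst[of L M t "\<lambda>b e. b \<in> X"] by (simp add: definable_iff_definable_rel)

text \<open>The sets \<open>S d\<close> are the instances of one formula, with \<open>d\<close> as a varying parameter.\<close>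

definition definable_family ::
  "('f, 'r) lang \<Rightarrow> ('f, 'r, 'a) struct \<Rightarrow> ('a \<Rightarrow> 'a set) \<Rightarrow> bool" where
  "definable_family L M S \<longleftrightarrow> definable_rel L M (\<lambda>e. e 0 \<in> S (e 1))"

lemma definable_rel_mem_family:
  assumes "definable_family L M S" "definable_fun L M s" "definable_fun L M t"
  shows "definable_rel L M (\<lambda>e. s e \<in> S (t e))"
  using assms definable_rel_subst2[of L M s t "\<lambda>x d. x \<in> S d"] by (simp add: definable_family_def)

lemma definable_family_formula:
  assumes "definable_family L M S"
  obtains \<psi> a where "wf_fm L \<psi>" and "\<And>x d. holds_at M x (\<psi>, a d) \<longleftrightarrow> x \<in> S d"
proof -
  obtain \<psi> \<tau> where
    *: "wf_fm L \<psi>" "\<And>x e. x \<in> S (e 0) \<longleftrightarrow> sat M ((env e \<tau>)(0 := x)) \<psi>"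
    using definable_rel_object_variable[OF assms[unfolded definable_family_def]] by auto
  show thesis
    by (rule that[of \<psi> "\<lambda>d. env (\<lambda>_. d) \<tau>"]) (simp_all add: * holds_at_def flip: *(2))
qed

section \<open>Saturation and burden in terms of definable families\<close>

text \<open>
  This makes countable parameter sets admissible for saturation in the successor of the size of
  the theory.
\<close>

lemma infinite_Th: "infinite (Th L M)"
proof -
  \<comment> \<open>Iterated double negations of a valid sentence.\<close>
  define f :: "nat \<Rightarrow> ('a, 'b) fm" where
    "f n = ((\<lambda>\<phi>. Neg (Neg \<phi>)) ^^ n) (Exi 0 (Eql (Var 0) (Var 0)))" for n
  have f_Suc: "f (Suc n) = Neg (Neg (f n))" for n
    by (simp add: f_def)
  have "size (f m) < size (f (Suc m))" for m
    by (simp add: f_Suc)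
  then have "strict_mono (\<lambda>n. size (f n))"
    by (simp add: strict_mono_Suc_iff)
  then have "inj f"
    by (metis injI strict_mono_eq)
  moreover have "f n \<in> Th L M" for n
    by (induction n) (auto simp: f_Suc Th_def, auto simp: f_def)
  ultimately show ?thesis
    by (metis finite_subset image_subsetI range_inj_infinite)
qed

text \<open>
  An instance of the formula of \<open>S\<close> involves only countably many parameters, hence so do countably
  many instances together.
\<close>

lemma saturated_countable_family:
  fixes d :: "nat \<Rightarrow> 'a"
  assumes sat: "saturated L M (cardSuc |Th L M| )"
    and S: "definable_family L M S"
    and fin: "\<And>n. \<exists>x. \<forall>k<n. x \<in> S (d k)"
  shows "\<exists>x. \<forall>k. x \<in> S (d k)"
proof -
  obtain \<psi> a where wf: "wf_fm L \<psi>" and a: "\<And>x d. holds_at M x (\<psi>, a d) \<longleftrightarrow> x \<in> S d"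
    using definable_family_formula[OF S] by blast
  define A where "A = (\<Union>k. range (a (d k)))"
  define \<Sigma> where "\<Sigma> = range (\<lambda>k. (\<psi>, a (d k)))"
  have "countable A"
    by (simp add: A_def)
  then obtain f :: "'a \<Rightarrow> nat" where "inj_on f A"
    unfolding countable_def ..
  moreover obtain g :: "nat \<Rightarrow> _" where "inj g" "range g \<subseteq> Th L M"
    using infinite_Th infinite_countable_subset by blast
  ultimately have "inj_on (g \<circ> f) A" "(g \<circ> f) ` A \<subseteq> Th L M"
    by (auto intro: comp_inj_on inj_on_subset)
  then have "|A| \<le>o |Th L M|"
    using card_of_ordLeq by blast
  then have "|A| <o cardSuc |Th L M|"
    using cardSuc_greater card_of_Card_order ordLeq_ordLess_trans by blast
  moreover have "\<forall>\<theta>\<in>\<Sigma>. pfm_over L A \<theta>"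
    by (auto simp: \<Sigma>_def pfm_over_def A_def wf)
  moreover have "consistent M \<Sigma>"
    unfolding consistent_def
  proof (intro allI impI)
    fix \<Sigma>0 assume "\<Sigma>0 \<subseteq> \<Sigma>" "finite \<Sigma>0"
    then obtain K where K: "finite K" "\<Sigma>0 = (\<lambda>k. (\<psi>, a (d k))) ` K"
      unfolding \<Sigma>_def by (meson finite_subset_image)
    then obtain n where "\<forall>k\<in>K. k < n"
      using finite_nat_set_iff_bounded by blast
    moreover obtain x where "\<forall>k<n. x \<in> S (d k)"
      using fin by blast
    ultimately show "\<exists>b. \<forall>\<theta>\<in>\<Sigma>0. holds_at M b \<theta>"
      using K a by (intro exI[of _ x]) auto
  qed
  ultimately have "\<exists>b. \<forall>\<theta>\<in>\<Sigma>. holds_at M b \<theta>"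
    using sat unfolding saturated_def by blast
  then show ?thesis
    by (auto simp: \<Sigma>_def a)
qed

text \<open>
  Disjointness is \<open>2\<close>-inconsistency, and a common element of the sets along a path gives
  consistency in \<open>M\<close> itself.
\<close>

lemma inp_pattern_if_definable_families:
  fixes n :: nat and d :: "nat \<Rightarrow> nat \<Rightarrow> 'a"
  assumes S: "\<And>i. i < n \<Longrightarrow> definable_family L M (S i)"
    and disj: "\<And>i. i < n \<Longrightarrow> disjoint_family (\<lambda>j. S i (d i j))"
    and real: "\<And>\<eta>. \<exists>x. \<forall>i<n. x \<in> S i (d i (\<eta> i))"
  shows "\<exists>\<phi> k a. inp_pattern L M {Eql (Var 0) (Var 0)} {..<n} \<phi> k a"
proof -
  have "\<exists>\<psi> a. wf_fm L \<psi> \<and> (\<forall>x c. holds_at M x (\<psi>, a c) \<longleftrightarrow> x \<in> S i c)" if "i < n" for i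
    using definable_family_formula[OF S[OF that]] by metis
  then obtain \<psi> a where wf: "\<And>i. i < n \<Longrightarrow> wf_fm L (\<psi> i)"
    and a: "\<And>i x c. i < n \<Longrightarrow> holds_at M x (\<psi> i, a i c) \<longleftrightarrow> x \<in> S i c"
    by metis
  have "\<not> consistent M {(\<psi> i, a i (d i j)) |j. j \<in> J}"
    if i: "i < n" and J: "finite J" "card J = 2" for i J
  proof
    assume cons: "consistent M {(\<psi> i, a i (d i j)) |j. j \<in> J}"
    obtain j j' where j: "J = {j, j'}" "j \<noteq> j'"
      using J by (meson card_2_iff)
    have "finite {(\<psi> i, a i (d i j)) |j. j \<in> J}"
      using J by simp
    from cons[unfolded consistent_def, rule_format, OF order_refl this]
    obtain b where "\<forall>\<theta>\<in>{(\<psi> i, a i (d i j)) |j. j \<in> J}. holds_at M b \<theta>" ..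
    then have "b \<in> S i (d i j)" "b \<in> S i (d i j')"
      using j a[OF i] by auto
    then show False
      using disj[OF i] j by (auto simp: disjoint_family_on_def)
  qed
  moreover have
    "consistent M ({Eql (Var 0) (Var 0)} \<times> UNIV \<union> {(\<psi> i, a i (d i (\<eta> i))) |i. i \<in> {..<n}})" for \<eta>
  proof -
    obtain x where "\<forall>i<n. x \<in> S i (d i (\<eta> i))"
      using real by blast
    then have "\<forall>\<theta>\<in>{Eql (Var 0) (Var 0)} \<times> UNIV \<union> {(\<psi> i, a i (d i (\<eta> i))) |i. i \<in> {..<n}}.
        holds_at M x \<theta>"
      using a by (auto simp: holds_at_def[of _ _ "(Eql _ _, _)"])
    then show ?thesis
      unfolding consistent_def by blast
  qed
  ultimately have
    "inp_pattern L M {Eql (Var 0) (Var 0)} {..<n} \<psi> (\<lambda>_. 2) (\<lambda>i j. a i (d i j))"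
    unfolding inp_pattern_def using wf by auto
  then show ?thesis
    by blast
qed

lemma not_burden_at_most_if_inp_patterns:
  assumes "\<And>m::nat. \<exists>\<phi> k a. inp_pattern L M {Eql (Var 0) (Var 0)} {..<m} \<phi> k a"
  shows "\<not> burden_at_most L M n"
proof -
  have "is_model M (Th L M)"
    by (auto simp: is_model_def Th_def)
  then show ?thesis
    using assms unfolding burden_at_most_def has_burden_def burden_less_def by blast
qed

section \<open>Expansions of densely ordered groups\<close>

text \<open>In place of division by two: if \<open>0 < k < \<delta>\<close>, the smaller of \<open>k\<close> and \<open>\<delta> - k\<close> will do.\<close>

lemma ex_double_le:
  fixes \<delta> :: "'a::{linordered_ab_group_add, dense_linorder}"
  assumes "\<delta> > 0"
  obtains h where "h > 0" "h + h \<le> \<delta>"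
proof -
  obtain k where k: "0 < k" "k < \<delta>"
    using dense assms by blast
  have "min k (\<delta> - k) + min k (\<delta> - k) \<le> k + (\<delta> - k)"
    by (intro add_mono) auto
  then show thesis
    using that[of "min k (\<delta> - k)"] k by auto
qed

lemma definable_fun_plus:
  assumes "expands_ordered_group L R pls lt" "definable_fun L R s" "definable_fun L R t"
  shows "definable_fun L R (\<lambda>e. s e + t e)"
proof -
  have "definable_rel L R (\<lambda>e. e (Suc (Suc 0)) = e (Suc 0) + e 0)"
    using assms(1)
    by (intro definable_relI[of L "Eql (Var 2) (App pls [Var 1, Var 0])" _ R Inl])
      (auto simp: env_def expands_ordered_group_def numeral_2_eq_2)
  then have "definable_rel L R (\<lambda>e. e (Suc 0) = e 0 + t (\<lambda>i. e (Suc (Suc i))))"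
    by (rule definable_rel_subst[OF definable_fun_reindex[OF assms(3)]])
  then show ?thesis
    unfolding definable_fun_def
    by (rule definable_rel_subst[OF definable_fun_reindex[OF assms(2)]])
qed

lemma definable_rel_less:
  assumes "expands_ordered_group L R pls lt" "definable_fun L R s" "definable_fun L R t"
  shows "definable_rel L R (\<lambda>e. s e < t e)"
  using assms(1)
  by (intro definable_rel_subst2[OF assms(2,3)]
      definable_relI[of L "Rel lt [Var 0, Var 1]" _ R Inl])
    (auto simp: env_def expands_ordered_group_def)

section \<open>Gaps of a Cantor-like set\<close>

definition gap_points :: "'a::linordered_ab_group_add set \<Rightarrow> 'a \<Rightarrow> 'a set" where
  "gap_points X \<epsilon> = {p \<in> X. \<forall>q\<in>X. p < q \<longrightarrow> p + \<epsilon> < q}"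

lemma gap_points_antimono: "\<epsilon>' \<le> \<epsilon> \<Longrightarrow> gap_points X \<epsilon> \<subseteq> gap_points X \<epsilon>'"
  unfolding gap_points_def by (auto intro: le_less_trans add_left_mono)

text \<open>
  The open intervals from an \<open>\<epsilon>\<close>-gap point \<open>y\<close> to \<open>y + \<epsilon>\<close> are disjoint, so \<open>y\<close> can be read off
  from any element of its interval.
\<close>

lemma gap_points_plus_unique:
  assumes "y \<in> gap_points X \<epsilon>" "y' \<in> gap_points X \<epsilon>" "0 < z" "z < \<epsilon>" "0 < z'" "z' < \<epsilon>"
    and eq: "y + z = y' + z'"
  shows "y = y'"
proof (rule ccontr)
  have *: "u + w < v + w'"
    if "u \<in> gap_points X \<epsilon>" "v \<in> gap_points X \<epsilon>" "w < \<epsilon>" "0 < w'" "u < v" for u v w w'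
  proof -
    have "u + w < u + \<epsilon>"
      using that by simp
    also have "\<dots> < v"
      using that by (auto simp: gap_points_def)
    also have "v < v + w'"
      using that by simp
    finally show ?thesis .
  qed
  assume "y \<noteq> y'"
  then show False
    using *[of y y' z z'] *[of y' y z' z] assms by (auto simp: neq_iff)
qed

lemma definable_rel_gap_points:
  assumes "expands_ordered_group L R pls lt" "definable L R X"
    "definable_fun L R s" "definable_fun L R t"
  shows "definable_rel L R (\<lambda>e. s e \<in> gap_points X (t e))"
proof (rule definable_rel_subst2[OF assms(3,4)])
  have "definable_rel L R (\<lambda>e. e 0 \<in> X \<and> (\<forall>q. q \<in> X \<longrightarrow> e 0 < q \<longrightarrow> e 0 + e 1 < q))"
    by (intro definable_rel_conj definable_rel_all definable_rel_imp definable_rel_mem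
        definable_rel_less[OF assms(1)] definable_fun_plus[OF assms(1)] definable_fun_var assms(2))
  then show "definable_rel L R (\<lambda>e. e 0 \<in> gap_points X (e 1))"
    by (simp add: gap_points_def Ball_def)
qed

text \<open>
  Take a point \<open>y\<close> outside \<open>X\<close> between \<open>p\<close> and \<open>q\<close>.  The supremum \<open>g\<close> of the part of \<open>X\<close> below \<open>y\<close>
  belongs to \<open>X\<close>, which is closed, and every later point of \<open>X\<close> lies beyond \<open>y\<close>; so any positive
  \<open>\<epsilon> < y - g\<close> is a witness.
\<close>

lemma gap_point_between:
  fixes R :: "('f, 'r, 'a::{linordered_ab_group_add, dense_linorder, linorder_topology}) struct"
  assumes grp: "expands_ordered_group L R pls lt" and compl: "definably_complete L R"
    and X: "definable L R X" "closed X" "interior X = {}"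
    and pq: "p \<in> X" "p < q"
  obtains g \<epsilon> where "\<epsilon> > 0" "g \<in> gap_points X \<epsilon>" "p \<le> g" "g < q"
proof -
  obtain y where y: "p < y" "y < q" "y \<notin> X"
  proof -
    have "\<not> {p<..<q} \<subseteq> X"
      using interior_maximal[of "{p<..<q}" X] X(3) dense[OF pq(2)] by auto
    then obtain y where "y \<in> {p<..<q}" "y \<notin> X"
      by blast
    then show thesis
      by (intro that) auto
  qed
  let ?Y = "{x \<in> X. x < y}"
  have "definable_rel L R (\<lambda>e. e 0 \<in> X \<and> e 0 < y)"
    by (intro definable_rel_conj definable_rel_mem definable_rel_less[OF grp]
        definable_fun_var definable_fun_const X)
  then have "definable L R ?Y"
    by (simp add: definable_iff_definable_rel)
  moreover have "p \<in> ?Y" "bdd_above ?Y"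
    using pq y by (auto intro!: bdd_aboveI[of _ y])
  ultimately obtain g where ub: "\<And>x. x \<in> ?Y \<Longrightarrow> x \<le> g" and least: "\<And>u. (\<forall>x\<in>?Y. x \<le> u) \<Longrightarrow> g \<le> u"
    using compl unfolding definably_complete_def by blast
  have "p \<le> g" "g \<le> y"
    using ub[OF \<open>p \<in> ?Y\<close>] least[of y] by (auto simp: less_imp_le)
  have "g \<in> X"
  proof (rule ccontr)
    assume "g \<notin> X"
    then have "p < g"
      using \<open>p \<le> g\<close> pq(1) by (auto simp: le_less)
    then obtain b where b: "b < g" "{b<..g} \<subseteq> - X"
      using open_left[of "- X" g p] X(2) \<open>g \<notin> X\<close> by auto
    have "\<forall>x\<in>?Y. x \<le> b"
    proof
      fix x assume "x \<in> ?Y"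
      then show "x \<le> b"
        using b(2) ub[of x] by (force simp: not_le[symmetric])
    qed
    then show False
      using least[of b] b(1) by auto
  qed
  then have "g < y"
    using \<open>g \<le> y\<close> y(3) by (auto simp: le_less)
  then obtain \<epsilon> where \<epsilon>: "0 < \<epsilon>" "\<epsilon> < y - g"
    using dense[of 0 "y - g"] by auto
  have "g + \<epsilon> < q'" if "q' \<in> X" "g < q'" for q'
  proof -
    have "y \<le> q'"
      using that ub[of q'] by force
    then show ?thesis
      using \<epsilon>(2) by (simp add: algebra_simps)
  qed
  then show thesis
    using that[of \<epsilon> g] \<epsilon>(1) \<open>g \<in> X\<close> \<open>p \<le> g\<close> \<open>g < y\<close> y(2) by (auto simp: gap_points_def)
qed

text \<open>
  Gap points separate the infinitely many points of \<open>X\<close> in the interval, so there are infinitely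
  many of them.  The set of \<open>\<epsilon>\<close>-gap points grows as \<open>\<epsilon>\<close> decreases, so any finitely many gap points
  admit a common \<open>\<epsilon>\<close>, and saturation makes \<open>\<epsilon>\<close> common to a whole sequence.
\<close>

lemma infinite_gap_points:
  fixes R :: "('f, 'r, 'a::{linordered_ab_group_add, dense_linorder, linorder_topology}) struct"
  assumes grp: "expands_ordered_group L R pls lt" and compl: "definably_complete L R"
    and sat: "saturated L R (cardSuc |Th L R| )"
    and X: "definable L R X" "closed X" "interior X = {}"
    and x0: "x0 \<in> X" "\<not> x0 isolated_in X" "a < x0" "x0 < b"
  obtains \<epsilon> where "\<epsilon> > 0" "infinite (gap_points X \<epsilon> \<inter> {a<..<b})"
proof -
  have "infinite (X \<inter> {a<..<b})"
  proof
    assume fin: "finite (X \<inter> {a<..<b})"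
    have "open ({a<..<b} - (X \<inter> {a<..<b} - {x0}))"
      using fin by (intro open_Diff finite_imp_closed) auto
    moreover have "({a<..<b} - (X \<inter> {a<..<b} - {x0})) \<inter> X = {x0}"
      using x0 by auto
    ultimately show False
      using x0 unfolding isolated_in_def by blast
  qed
  define G where "G = (\<Union>\<epsilon>\<in>{0<..}. gap_points X \<epsilon>) \<inter> {a<..<b}"
  have between: "\<exists>g\<in>G. p \<le> g \<and> g < q" if "p \<in> X \<inter> {a<..<b}" "q \<in> X \<inter> {a<..<b}" "p < q" for p q
  proof -
    have "p \<in> X"
      using that by blast
    then obtain g \<epsilon> where "\<epsilon> > 0" "g \<in> gap_points X \<epsilon>" "p \<le> g" "g < q"
      using gap_point_between[OF grp compl X _ \<open>p < q\<close>] by blast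
    then show ?thesis
      using that by (intro bexI[of _ g]) (auto simp: G_def)
  qed
  have "infinite G"
  proof
    assume "finite G"
    have "inj_on (\<lambda>p. {g \<in> G. g < p}) (X \<inter> {a<..<b})"
    proof (rule linorder_inj_onI)
      fix p q assume "p < q" "p \<in> X \<inter> {a<..<b}" "q \<in> X \<inter> {a<..<b}"
      then obtain g where "g \<in> G" "p \<le> g" "g < q"
        using between by blast
      then have "g \<in> {g \<in> G. g < q}" "g \<notin> {g \<in> G. g < p}"
        by auto
      then show "{g \<in> G. g < p} \<noteq> {g \<in> G. g < q}"
        by blast
    qed auto
    moreover have "(\<lambda>p. {g \<in> G. g < p}) ` (X \<inter> {a<..<b}) \<subseteq> Pow G"
      by auto
    ultimately show False
      using \<open>infinite (X \<inter> {a<..<b})\<close> \<open>finite G\<close> by (meson finite_Pow_iff inj_on_finite)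
  qed
  then obtain g :: "nat \<Rightarrow> 'a" where g: "inj g" "range g \<subseteq> G"
    using infinite_countable_subset by blast
  then have "\<forall>k. \<exists>\<epsilon>>0. g k \<in> gap_points X \<epsilon>"
    by (force simp: G_def)
  then obtain w where w: "\<And>k. w k > 0" "\<And>k. g k \<in> gap_points X (w k)"
    by metis
  have "\<exists>x. \<forall>k. x \<in> {x. 0 < x \<and> g k \<in> gap_points X x}"
  proof (rule saturated_countable_family[OF sat])
    show "definable_family L R (\<lambda>d. {x. 0 < x \<and> d \<in> gap_points X x})"
      unfolding definable_family_def mem_Collect_eq
      by (intro definable_rel_conj definable_rel_less[OF grp] definable_rel_gap_points[OF grp]
          definable_fun_var definable_fun_const X)
    fix n
    let ?\<epsilon> = "Min (w ` {..n})"
    have "g k \<in> gap_points X ?\<epsilon>" if "k < n" for k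
      using w(2)[of k] gap_points_antimono[of ?\<epsilon> "w k" X] that by (auto simp: subset_iff)
    then show "\<exists>x. \<forall>k<n. x \<in> {x. 0 < x \<and> g k \<in> gap_points X x}"
      using w(1) by (intro exI[of _ ?\<epsilon>]) auto
  qed
  then obtain \<epsilon> where \<epsilon>: "\<And>k. 0 < \<epsilon> \<and> g k \<in> gap_points X \<epsilon>"
    by auto
  then have "range g \<subseteq> gap_points X \<epsilon> \<inter> {a<..<b}"
    using g(2) by (auto simp: G_def)
  then show thesis
    using that[of \<epsilon>] \<epsilon> g(1) by (meson finite_subset range_inj_infinite)
qed

section \<open>Independent families at nested scales\<close>

text \<open>
  The bound \<open>\<delta>\<close> on the realizations makes the induction on the depth possible.  The new row
  consists of infinitely many \<open>\<epsilon>\<close>-gap points \<open>g j\<close> in an interval of length at most \<open>h\<close>, where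
  \<open>h + h \<le> \<delta>\<close>, translated by the left end \<open>a\<close> of the interval.  A pattern of depth \<open>n\<close> with
  realizations \<open>z\<close> below both \<open>\<epsilon>\<close> and \<open>h\<close> is copied into the space to the right of each gap point:
  as \<open>g j + z\<close> determines both summands, the old rows speak about \<open>z\<close> and the new row about \<open>g j\<close>,
  independently.
\<close>

lemma nested_scales:
  fixes R :: "('f, 'r, 'a::{linordered_ab_group_add, dense_linorder, linorder_topology}) struct"
    and n :: nat
  assumes grp: "expands_ordered_group L R pls lt" and compl: "definably_complete L R"
    and sat: "saturated L R (cardSuc |Th L R| )"
    and X: "definable L R X" "Cantor_like X"
    and "\<delta> > 0"
  shows "\<exists>S d. (\<forall>i<n. definable_family L R (S i)) \<and>
    (\<forall>i<n. disjoint_family (\<lambda>j::nat. S i (d i j))) \<and>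
    (\<forall>\<eta>. \<exists>x. 0 < x \<and> x < \<delta> \<and> (\<forall>i<n. x \<in> S i (d i (\<eta> i))))"
  using \<open>\<delta> > 0\<close>
proof (induction n arbitrary: \<delta>)
  case 0
  then show ?case
    using dense by auto
next
  case (Suc n)
  obtain h where h: "h > 0" "h + h \<le> \<delta>"
    using ex_double_le[OF Suc.prems] by blast
  obtain h' where h': "h' > 0" "h' + h' \<le> h"
    using ex_double_le[OF h(1)] by blast
  have X': "closed X" "interior X = {}"
    using X(2) by (auto simp: Cantor_like_def)
  obtain x0 where x0: "x0 \<in> X" "\<not> x0 isolated_in X"
    using X(2) unfolding Cantor_like_def by blast
  define a where "a = x0 - h'"
  obtain \<epsilon> where \<epsilon>: "\<epsilon> > 0" "infinite (gap_points X \<epsilon> \<inter> {a<..<x0 + h'})"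
    using infinite_gap_points[OF grp compl sat X(1) X' x0, of a "x0 + h'"] h'
    by (auto simp: a_def)
  then obtain g :: "nat \<Rightarrow> 'a" where
    g: "inj g" "range g \<subseteq> gap_points X \<epsilon> \<inter> {a<..<x0 + h'}"
    using infinite_countable_subset by blast
  have "min \<epsilon> h > 0"
    using \<epsilon> h by simp
  from Suc.IH[OF this] obtain S d where
    S: "\<And>i. i < n \<Longrightarrow> definable_family L R (S i)" and
    disj: "\<And>i. i < n \<Longrightarrow> disjoint_family (\<lambda>j::nat. S i (d i j))" and
    real: "\<And>\<eta>. \<exists>x. 0 < x \<and> x < min \<epsilon> h \<and> (\<forall>i<n. x \<in> S i (d i (\<eta> i)))"
    by auto
  \<comment> \<open>In \<open>S0\<close> the new row, in \<open>S'\<close> the old rows, copied to every \<open>\<epsilon>\<close>-gap point of \<open>X\<close>.\<close>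
  define S0 where "S0 c = {x. c < x + a \<and> x + a < c + \<epsilon>}" for c
  define S' where "S' i c =
      {x. \<exists>y z. y \<in> gap_points X \<epsilon> \<and> 0 < z \<and> z < \<epsilon> \<and> z \<in> S i c \<and> x + a = y + z}" for i c
  have "definable_family L R S0"
    unfolding definable_family_def S0_def mem_Collect_eq
    by (intro definable_rel_conj definable_rel_less[OF grp] definable_fun_plus[OF grp]
        definable_fun_var definable_fun_const)
  moreover have "definable_family L R (S' i)" if "i < n" for i
    unfolding definable_family_def S'_def mem_Collect_eq
    by (intro definable_rel_ex definable_rel_conj definable_rel_less[OF grp] definable_rel_eq
        definable_rel_gap_points[OF grp] definable_rel_mem_family[OF S[OF that]]
        definable_fun_plus[OF grp] definable_fun_var definable_fun_const X)
  moreover have "disjoint_family (\<lambda>j. S0 (g j))"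
    unfolding disjoint_family_on_def
  proof (intro ballI impI, rule ccontr)
    fix j j' assume "j \<noteq> j'" "S0 (g j) \<inter> S0 (g j') \<noteq> {}"
    then obtain x where x: "x \<in> S0 (g j)" "x \<in> S0 (g j')"
      by blast
    have "g j = g j'"
      by (rule gap_points_plus_unique[of _ X \<epsilon> _ "x + a - g j" "x + a - g j'"])
        (use x g(2) in \<open>auto simp: S0_def algebra_simps\<close>)
    then show False
      using g(1) \<open>j \<noteq> j'\<close> by (auto dest: injD)
  qed
  moreover have "disjoint_family (\<lambda>j. S' i (d i j))" if "i < n" for i
    unfolding disjoint_family_on_def
  proof (intro ballI impI, rule ccontr)
    fix j j' assume "j \<noteq> j'" "S' i (d i j) \<inter> S' i (d i j') \<noteq> {}"
    then obtain x y z y' z' where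
      y: "y \<in> gap_points X \<epsilon>" "0 < z" "z < \<epsilon>" "z \<in> S i (d i j)" "x + a = y + z" and
      y': "y' \<in> gap_points X \<epsilon>" "0 < z'" "z' < \<epsilon>" "z' \<in> S i (d i j')" "x + a = y' + z'"
      unfolding S'_def by blast
    have "y = y'"
      by (rule gap_points_plus_unique[of y X \<epsilon> y' z z']) (use y y' in auto)
    then have "z = z'"
      using y(5) y'(5) by simp
    then show False
      using y(4) y'(4) disj[OF that] \<open>j \<noteq> j'\<close> by (auto simp: disjoint_family_on_def)
  qed
  moreover have "\<exists>x. 0 < x \<and> x < \<delta> \<and> x \<in> S0 (g (\<eta> 0)) \<and> (\<forall>i<n. x \<in> S' i (d i (\<eta> (Suc i))))" for \<eta>
  proof -
    obtain z where z: "0 < z" "z < \<epsilon>" "z < h" "\<forall>i<n. z \<in> S i (d i (\<eta> (Suc i)))"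
      using real[of "\<lambda>i. \<eta> (Suc i)"] by auto
    have gp: "g (\<eta> 0) \<in> gap_points X \<epsilon>" "a < g (\<eta> 0)" "g (\<eta> 0) < x0 + h'"
      using subsetD[OF g(2), of "g (\<eta> 0)"] by auto
    have "g (\<eta> 0) - a < h' + h'"
      using gp(3) by (simp add: a_def algebra_simps)
    then have "g (\<eta> 0) - a < h"
      using h'(2) by simp
    then have "g (\<eta> 0) - a + z < h + h"
      using z(3) by (rule add_strict_mono)
    then have "g (\<eta> 0) - a + z < \<delta>"
      using h(2) by simp
    moreover have "0 < g (\<eta> 0) - a + z"
      using gp(2) z(1) by (simp add: add_pos_pos)
    moreover have "g (\<eta> 0) - a + z + a = g (\<eta> 0) + z"
      by simp
    ultimately show ?thesis
      using z gp(1) by (intro exI[of _ "g (\<eta> 0) - a + z"]) (auto simp: S0_def S'_def)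
  qed
  ultimately show ?case
    by (intro exI[of _ "case_nat S0 S'"] exI[of _ "case_nat g d"])
      (simp add: All_less_Suc2)
qed

theorem theorem2p5:
  fixes L :: "('f, 'r) lang"
    and R :: "('f, 'r, 'a::{linordered_ab_group_add, dense_linorder, linorder_topology}) struct"
    and pls :: 'f and lt :: 'r
  assumes "expands_ordered_group L R pls lt"
    and "saturated L R (cardSuc |Th L R| )"
    and "definably_complete L R"
    and "burden_at_most L R 2"
  shows "\<not> (\<exists>X. definable L R X \<and> Cantor_like X)"
proof
  assume "\<exists>X. definable L R X \<and> Cantor_like X"
  then obtain X where X: "definable L R X" "Cantor_like X"
    by blast
  \<comment> \<open>A positive element exists: a trivial group has no nonempty subset with empty interior.\<close>
  then have "X \<noteq> {}" "X \<noteq> UNIV"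
    by (auto simp: Cantor_like_def)
  then obtain x y where "x \<in> X" "y \<notin> X"
    by blast
  then obtain \<delta> :: 'a where "\<delta> > 0"
    using that[of "x - y"] that[of "y - x"] by (cases x y rule: linorder_cases) auto
  have "\<exists>\<phi> k a. inp_pattern L R {Eql (Var 0) (Var 0)} {..<n} \<phi> k a" for n :: nat
    using nested_scales[OF assms(1,3,2) X \<open>\<delta> > 0\<close>, of n] inp_pattern_if_definable_families[of n L R]
    by metis
  then show False
    using not_burden_at_most_if_inp_patterns assms(4) by blast
qed

end
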